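(* Let $s\in(0,1)$, $m\ge2$, $h,\tau>0$, let the weights satisfy $(A_m)$ with constant $C_s>0$, and let $\{V_i^0\}_{i\in\mathbb{Z}}$ and $\{W_i^0\}_{i\in\mathbb{Z}}$ be real sequences nondecreasing in $i$. Let $C_1^{-1}=C_sm(2M)^{m-1}$, $C_2^{-1}=C_smL^{m-2}\max\{L,2M\}$, and $f_s(h)=1$ if $s\ne\frac12$, $f_s(h)=\frac1{|\log h|}$ if $s=\frac12$. Assume that one of the following holds (with constants $M,L$): (CFLa) $|V^0_i|,|W^0_i|\le M$ for all $i\in\mathbb{Z}$, and $\tau\le C_1h^{2s+m-1}$; (CFLb) $|V^0_i|,|W^0_i|\le M$ and $\frac{|V^0_{i+1}-V^0_i|}{h},\frac{|W^0_{i+1}-W^0_i|}{h}\le L$ for all $i\in\mathbb{Z}$, and $\tau\le C_2h^{\max\{2s,1\}}f_s(h)$. Then the solutions $V_i^j$ and $W_i^j$ of the scheme starting from $V^0$ and $W^0$ satisfy: (a) (Nondecreasing) $V_i^j\le V_{i+1}^j$ for all $i\in\mathbb{Z}$, $j\in\mathbb{N}$. (b) ($\ell^\infty$-stability) $\sup_{i\in\mathbb{Z},j\in\mathbb{N}}|V_i^j|\le\sup_{i\in\mathbb{Z}}|V_i^0|\le M$. (c) (Nonnegativity) If $V_i^0\ge0$ for all $i\in\mathbb{Z}$, then $V_i^j\ge0$ for all $i\in\mathbb{Z}$, $j\in\mathbb{N}$. (d) (Comparison) If $V_i^0\le W_i^0$ for all $i\in\mathbb{Z}$, then $V_i^j\le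 W_i^j$ for all $i\in\mathbb{Z}$, $j\in\mathbb{N}$. (e) ($\ell^\infty$-contraction) $\sup_{i\in\mathbb{Z},j\in\mathbb{N}}|W_i^j-V_i^j|\le\sup_{i\in\mathbb{Z}}|W_i^0-V_i^0|$. (f) (Lipschitz stability) $\sup_{i\in\mathbb{Z},j\in\mathbb{N}}\frac{|V_{i+1}^j-V_i^j|}{h}\le\sup_{i\in\mathbb{Z}}\frac{|V_{i+1}^0-V_i^0|}{h}$ for all $h>0$.
   Context: Weights: $\omega_k=\omega_k(h)$, $k\in\mathbb{Z}\setminus\{0\}$, with $\omega_k=\omega_{-k}\ge0$. For a bounded grid function $\phi=(\phi_i)_{i\in\mathbb{Z}}$: $$(-\Delta)_h^s\phi_i=\sum_{k\neq0}(\phi_i-\phi_{i+k})\omega_k,\qquad D_h\phi_i=\begin{cases}\frac{\phi_{i+1}-\phi_i}{h}&\text{if }(-\Delta)^s_h\phi_i\le0,\\ \frac{\phi_i-\phi_{i-1}}{h}&\text{if }(-\Delta)^s_h\phi_i>0,\end{cases}\qquad L^s_h[\phi]_i=-\max\{D_h\phi_i,0\}^{m-1}(-\Delta)^s_h\phi_i.$$ The scheme is $V_i^{j+1}=V_i^j+\tau L_h^s[V^j_\cdot]_i$, $i\in\mathbb{Z}$, $j\in\mathbb{N}=\{0,1,2,\dots\}$ (and likewise for $W$). $(A_m)$: $\sum_{k\ne0}\omega_k\le C_sh^{-2s}$, $\sum_{|kh|>1}\omega_k\le C_s$, and $\sum_{0<|kh|\le1}|hk|\omega_k\le C_s\rho_s(h)$,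 where $\rho_s(h)=h^{1-2s}$ if $s>\frac12$, $|\log h|$ if $s=\frac12$, $1$ if $s<\frac12$.
   Formalization: For s=1/2 under (CFLb) the bound τ ≤ C_2 h is assumed in addition to τ ≤ C_2 h/|log h|; it is automatic when |log h| ≥ 1. Without it, ℓ^∞-stability (b) fails for h near 1, since 1/|log h| is unbounded there. *)

theory Defs
  imports "HOL-Analysis.Analysis"
begin

text \<open>
  Grid functions have type \<open>int \<Rightarrow> real\<close>; the weights are \<open>\<omega> :: int \<Rightarrow> real\<close>, and
  \<open>\<omega> 0\<close> is never used. The exponent \<open>m\<close> is real, hence \<open>powr\<close>.
\<close>

definition rho :: "real \<Rightarrow> real \<Rightarrow> real" where
  "rho s h = (if s > 1/2 then h powr (1 - 2 * s) else if s = 1/2 then \<bar>ln h\<bar> else 1)"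

definition weights :: "(int \<Rightarrow> real) \<Rightarrow> bool" where
  "weights \<omega> \<longleftrightarrow> (\<forall>k. k \<noteq> 0 \<longrightarrow> \<omega> k = \<omega> (- k) \<and> 0 \<le> \<omega> k)"

text \<open>
  Summability has to be required explicitly, since a divergent \<^const>\<open>infsum\<close> is \<open>0\<close>.
  It gives convergence of the second sum as well; the third one is finite.
\<close>

definition A_m :: "real \<Rightarrow> real \<Rightarrow> real \<Rightarrow> (int \<Rightarrow> real) \<Rightarrow> bool" where
  "A_m s h C \<omega> \<longleftrightarrow>
     \<omega> summable_on {k. k \<noteq> 0} \<and>
     (\<Sum>\<^sub>\<infinity>k\<in>{k. k \<noteq> 0}. \<omega> k) \<le> C * h powr (- 2 * s) \<and>
     (\<Sum>\<^sub>\<infinity>k\<in>{k. \<bar>of_int k * h\<bar> > 1}. \<omega> k) \<le> C \<and>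
     (\<Sum>\<^sub>\<infinity>k\<in>{k. 0 < \<bar>of_int k * h\<bar> \<and> \<bar>of_int k * h\<bar> \<le> 1}. \<bar>h * of_int k\<bar> * \<omega> k)
        \<le> C * rho s h"

definition frac_lap :: "(int \<Rightarrow> real) \<Rightarrow> (int \<Rightarrow> real) \<Rightarrow> int \<Rightarrow> real" where
  "frac_lap \<omega> \<phi> i = (\<Sum>\<^sub>\<infinity>k\<in>{k. k \<noteq> 0}. (\<phi> i - \<phi> (i + k)) * \<omega> k)"

definition upwind_diff :: "real \<Rightarrow> (int \<Rightarrow> real) \<Rightarrow> (int \<Rightarrow> real) \<Rightarrow> int \<Rightarrow> real" where
  "upwind_diff h \<omega> \<phi> i =
     (if frac_lap \<omega> \<phi> i \<le> 0 then (\<phi> (i + 1) - \<phi> i) / h else (\<phi> i - \<phi> (i - 1)) / h)"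

definition scheme_op ::
    "real \<Rightarrow> real \<Rightarrow> (int \<Rightarrow> real) \<Rightarrow> (int \<Rightarrow> real) \<Rightarrow> int \<Rightarrow> real" where
  "scheme_op m h \<omega> \<phi> i =
     - (max (upwind_diff h \<omega> \<phi> i) 0 powr (m - 1)) * frac_lap \<omega> \<phi> i"

definition scheme_solution ::
    "real \<Rightarrow> real \<Rightarrow> real \<Rightarrow> (int \<Rightarrow> real) \<Rightarrow> (nat \<Rightarrow> int \<Rightarrow> real) \<Rightarrow> bool" where
  "scheme_solution m h \<tau> \<omega> V \<longleftrightarrow>
     (\<forall>j i. V (j + 1) i = V j i + \<tau> * scheme_op m h \<omega> (V j) i)"

text \<open>
  The three constants below are the reciprocals $C_1^{-1}$, $C_2^{-1}$ and $f_s(h)^{-1}$.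
  A condition $\tau \le C_1 r$ is written $\tau C_1^{-1} \le r$, which is equivalent if
  $C_1^{-1} > 0$ and reads $C_1 = \infty$ (not \<open>1 / 0 = 0\<close>) if $C_1^{-1} = 0$; likewise for
  $C_2$ and $f_s(h)$. Since \<open>0 powr 0 = 0\<close>, $C_2^{-1}$ also vanishes for $L = 0$, $m = 2$;
  then the data are constant and $\tau$ is unrestricted.
\<close>

definition C1_inv :: "real \<Rightarrow> real \<Rightarrow> real \<Rightarrow> real" where
  "C1_inv m C M = C * m * (2 * M) powr (m - 1)"

definition C2_inv :: "real \<Rightarrow> real \<Rightarrow> real \<Rightarrow> real \<Rightarrow> real" where
  "C2_inv m C M L = C * m * L powr (m - 2) * max L (2 * M)"

definition f_inv :: "real \<Rightarrow> real \<Rightarrow> real" where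
  "f_inv s h = (if s = 1/2 then \<bar>ln h\<bar> else 1)"

definition CFLa ::
    "real \<Rightarrow> real \<Rightarrow> real \<Rightarrow> real \<Rightarrow> real \<Rightarrow> real \<Rightarrow> (int \<Rightarrow> real) \<Rightarrow> (int \<Rightarrow> real) \<Rightarrow> bool" where
  "CFLa s m h \<tau> C M V0 W0 \<longleftrightarrow>
     (\<forall>i. \<bar>V0 i\<bar> \<le> M \<and> \<bar>W0 i\<bar> \<le> M) \<and>
     \<tau> * C1_inv m C M \<le> h powr (2 * s + m - 1)"

definition CFLb ::
    "real \<Rightarrow> real \<Rightarrow> real \<Rightarrow> real \<Rightarrow> real \<Rightarrow> real \<Rightarrow> real \<Rightarrow> (int \<Rightarrow> real) \<Rightarrow> (int \<Rightarrow> real) \<Rightarrow> bool"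
  where
  "CFLb s m h \<tau> C M L V0 W0 \<longleftrightarrow>
     (\<forall>i. \<bar>V0 i\<bar> \<le> M \<and> \<bar>W0 i\<bar> \<le> M) \<and>
     (\<forall>i. \<bar>V0 (i + 1) - V0 i\<bar> / h \<le> L \<and> \<bar>W0 (i + 1) - W0 i\<bar> / h \<le> L) \<and>
     \<tau> * C2_inv m C M L * f_inv s h \<le> h powr max (2 * s) 1"

text \<open>
  An extra hypothesis for $s = 1/2$ under \<^const>\<open>CFLb\<close>. Since $1/|\log h| \to \infty$ as $h \to 1$,
  \<^const>\<open>CFLb\<close> alone admits arbitrarily large $\tau$ for $h$ near $1$, where
  $\ell^\infty$-stability fails. It reads $\tau \le C_2 h^{\max\{2s,1\}}$ and already follows
  from \<^const>\<open>CFLb\<close> as soon as $|\log h| \ge 1$, in particular for all $h \le 1/e$.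
\<close>

definition log_guard :: "real \<Rightarrow> real \<Rightarrow> real \<Rightarrow> real \<Rightarrow> real \<Rightarrow> real \<Rightarrow> real \<Rightarrow> bool" where
  "log_guard s m h \<tau> C M L \<longleftrightarrow>
     (s = 1/2 \<longrightarrow> \<tau> * C2_inv m C M L \<le> h powr max (2 * s) 1)"

end

theory Submission
  imports Defs
begin

text \<open>
  One step $F\phi = \phi + \tau L_h^s[\phi]$ of the scheme commutes with shifts and with adding
  constants, and it fixes constants. So everything follows from one comparison principle: $F$ is
  order preserving on the class of nondecreasing grid functions with oscillation at most
  $N = 2M$ and slopes at most $B$, which is then invariant under $F$. For $\phi \le \psi$, raising
  the values away from $i$ only helps, and what is lost by raising the value at $i$ by
  $\delta = \psi_i - \phi_i$ is at most
  $\tau B^{m-2}((m-1) A / h + B \sum_k \omega_k)\,\delta \le \delta$, where $A$ bounds the discrete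
  fractional Laplacian on the class. Taking $B = \min\{L, 2M/h\}$ covers large $h$ as well, and
  the symmetry of the weights saves the factor $2$ that the constant in the CFL condition needs.
\<close>

section \<open>Preliminaries on real powers and the class of admissible grid functions\<close>

lemma mono_int_if_le_next:
  fixes f :: "int \<Rightarrow> 'a :: order"
  assumes "\<And>i. f i \<le> f (i + 1)"
  shows "mono f"
proof
  fix i j :: int
  assume "i \<le> j"
  then show "f i \<le> f j"
    by (induction j rule: int_ge_induct) (auto intro: order_trans assms)
qed

text \<open>Splits one slope off the power, so that both terms of the flux estimate share the factor
  \<open>B powr (m - 2)\<close>. At \<open>b = 0\<close> both sides are \<open>0\<close>, because
  \<open>0 powr x = 0\<close> for every \<open>x\<close>.\<close>

lemma powr_minus_two_mult:
  fixes b m :: real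
  assumes "0 \<le> b"
  shows "b powr (m - 2) * b = b powr (m - 1)"
proof (cases "b = 0")
  case False
  then show ?thesis
    using assms by (simp add: powr_diff power2_eq_square)
qed simp

lemma powr_diff_le:
  fixes p d e b :: real
  assumes "1 \<le> p" "0 \<le> e" "e \<le> d" "d \<le> b"
  shows "d powr p - e powr p \<le> p * b powr (p - 1) * (d - e)"
proof (cases "e = d")
  case False
  with assms have lt: "e < d" by simp
  have "\<exists>l z. e < z \<and> z < d \<and> ((\<lambda>x. x powr p) has_real_derivative l) (at z) \<and>
      d powr p - e powr p = (d - e) * l"
  proof (rule MVT)
    show "e < d" by (fact lt)
    show "continuous_on {e..d} (\<lambda>x. x powr p)"
      using assms by (intro continuous_on_powr' continuous_intros) auto
    show "(\<lambda>x. x powr p) differentiable (at x)" if "e < x" "x < d" for x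
      using has_real_derivative_powr[of x p] that assms
      unfolding real_differentiable_def by force
  qed
  then obtain l z where z: "e < z" "z < d" and l: "((\<lambda>x. x powr p) has_real_derivative l) (at z)"
      and eq: "d powr p - e powr p = (d - e) * l"
    by blast
  have "l = p * z powr (p - 1)"
    using DERIV_unique[OF l has_real_derivative_powr] z assms by auto
  moreover have "p * z powr (p - 1) \<le> p * b powr (p - 1)"
    using z assms by (intro mult_left_mono powr_mono2) auto
  ultimately show ?thesis
    using eq lt by (simp add: mult.commute[of _ "d - e"] mult_left_mono)
qed simp

text \<open>The oscillation is bounded instead of the absolute values, so that the class is closed
  under adding constants.\<close>

definition grid_class :: "real \<Rightarrow> real \<Rightarrow> real \<Rightarrow> (int \<Rightarrow> real) set" where
  "grid_class h N B =
     {\<phi>. mono \<phi> \<and> (\<forall>i j. \<phi> j - \<phi> i \<le> N) \<and> (\<forall>i. \<phi> (i + 1) - \<phi> i \<le> h * B)}"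

lemma grid_class_monoD: "\<phi> \<in> grid_class h N B \<Longrightarrow> i \<le> j \<Longrightarrow> \<phi> i \<le> \<phi> j"
  by (auto simp: grid_class_def mono_def)

lemma grid_class_oscD: "\<phi> \<in> grid_class h N B \<Longrightarrow> \<bar>\<phi> j - \<phi> i\<bar> \<le> N"
  by (auto simp: grid_class_def abs_le_iff)

lemma grid_class_slopeD: "\<phi> \<in> grid_class h N B \<Longrightarrow> \<phi> (i + 1) - \<phi> i \<le> h * B"
  by (auto simp: grid_class_def)

lemma grid_class_const: "0 \<le> N \<Longrightarrow> 0 \<le> h * B \<Longrightarrow> (\<lambda>_. a) \<in> grid_class h N B"
  by (auto simp: grid_class_def mono_def)

lemma grid_class_add_const: "\<phi> \<in> grid_class h N B \<Longrightarrow> (\<lambda>i. \<phi> i + c) \<in> grid_class h N B"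
  by (auto simp: grid_class_def mono_def)

lemma grid_class_shift: "\<phi> \<in> grid_class h N B \<Longrightarrow> (\<lambda>i. \<phi> (i + 1)) \<in> grid_class h N B"
  unfolding grid_class_def mono_def mem_Collect_eq by (meson add_right_mono)

lemma grid_class_slopeD_nat:
  assumes "\<phi> \<in> grid_class h N B"
  shows "\<phi> (i + int n) - \<phi> i \<le> real n * (h * B)"
proof (induction n)
  case (Suc n)
  then show ?case
    using grid_class_slopeD[OF assms, of "i + int n"] by (simp add: algebra_simps)
qed simp

section \<open>The one-step map and its symmetries\<close>

definition scheme_step ::
    "real \<Rightarrow> real \<Rightarrow> real \<Rightarrow> (int \<Rightarrow> real) \<Rightarrow> (int \<Rightarrow> real) \<Rightarrow> int \<Rightarrow> real" where
  "scheme_step m h \<tau> \<omega> \<phi> i = \<phi> i + \<tau> * scheme_op m h \<omega> \<phi> i"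

lemma scheme_solution_step:
  "scheme_solution m h \<tau> \<omega> V \<Longrightarrow> V (Suc j) = scheme_step m h \<tau> \<omega> (V j)"
  by (auto simp: scheme_solution_def scheme_step_def)

lemma scheme_step_const: "scheme_step m h \<tau> \<omega> (\<lambda>_. a) i = a"
  by (simp add: scheme_step_def scheme_op_def frac_lap_def)

lemma scheme_step_add_const:
  "scheme_step m h \<tau> \<omega> (\<lambda>i. \<phi> i + c) i = scheme_step m h \<tau> \<omega> \<phi> i + c"
  by (simp add: scheme_step_def scheme_op_def frac_lap_def upwind_diff_def)

lemma scheme_step_shift:
  "scheme_step m h \<tau> \<omega> (\<lambda>i. \<phi> (i + 1)) i = scheme_step m h \<tau> \<omega> \<phi> (i + 1)"
  by (simp add: scheme_step_def scheme_op_def frac_lap_def upwind_diff_def ac_simps)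

section \<open>Summability and bounds for the discrete fractional Laplacian\<close>

lemma weights_nonneg: "weights \<omega> \<Longrightarrow> k \<noteq> 0 \<Longrightarrow> 0 \<le> \<omega> k"
  unfolding weights_def by blast

lemma weights_minus: "weights \<omega> \<Longrightarrow> k \<noteq> 0 \<Longrightarrow> \<omega> (- k) = \<omega> k"
  unfolding weights_def by metis

lemma infsum_weights_nonneg: "weights \<omega> \<Longrightarrow> 0 \<le> (\<Sum>\<^sub>\<infinity>k\<in>{k. k \<noteq> 0}. \<omega> k)"
  by (intro infsum_nonneg) (simp add: weights_nonneg)

text \<open>Stated for an arbitrary bounded factor, so that it serves both
  \<open>\<phi> i - \<phi> (i + k)\<close> and the reflected difference
  \<open>\<phi> i - \<phi> (i - k)\<close>.\<close>

lemma frac_lap_summable: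
  assumes "weights \<omega>" "\<omega> summable_on {k. k \<noteq> 0}" "\<And>k. \<bar>f k\<bar> \<le> N"
  shows "(\<lambda>k. f k * \<omega> k) summable_on {k. k \<noteq> 0}"
proof (rule Infinite_Sum.abs_summable_summable, rule Infinite_Sum.abs_summable_on_comparison_test)
  show "(\<lambda>k. norm (N * \<omega> k)) summable_on {k. k \<noteq> 0}"
    using summable_on_cmult_right[OF assms(2), of N]
    by (rule summable_on_iff_abs_summable_on_real[THEN iffD1])
  show "norm (f k * \<omega> k) \<le> norm (N * \<omega> k)" if "k \<in> {k. k \<noteq> 0}" for k
    using that assms(1) assms(3)[of k] unfolding norm_mult
    by (intro mult_right_mono) auto
qed

text \<open>Holds term by term: larger values at \<open>i + k\<close> only lower the Laplacian at
  \<open>i\<close>, so each weight picks up just the increment at \<open>i\<close> itself.\<close>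

lemma frac_lap_diff_le:
  assumes "weights \<omega>" "\<omega> summable_on {k. k \<noteq> 0}"
    and "\<phi> \<in> grid_class h N B" "\<psi> \<in> grid_class h N B" and "\<And>i. \<phi> i \<le> \<psi> i"
  shows "frac_lap \<omega> \<psi> i \<le> frac_lap \<omega> \<phi> i + (\<psi> i - \<phi> i) * (\<Sum>\<^sub>\<infinity>k\<in>{k. k \<noteq> 0}. \<omega> k)"
proof -
  have sum: "(\<lambda>k. (\<phi>' i - \<phi>' (i + k)) * \<omega> k) summable_on {k. k \<noteq> 0}"
    if "\<phi>' \<in> grid_class h N B" for \<phi>'
    by (rule frac_lap_summable[OF assms(1,2) grid_class_oscD[OF that]])
  have sum\<delta>: "(\<lambda>k. (\<psi> i - \<phi> i) * \<omega> k) summable_on {k. k \<noteq> 0}"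
    using assms(2) by (rule summable_on_cmult_right)
  have "frac_lap \<omega> \<psi> i \<le>
      (\<Sum>\<^sub>\<infinity>k\<in>{k. k \<noteq> 0}. (\<phi> i - \<phi> (i + k)) * \<omega> k + (\<psi> i - \<phi> i) * \<omega> k)"
    unfolding frac_lap_def
  proof (rule infsum_mono[OF sum[OF assms(4)] summable_on_add[OF sum[OF assms(3)] sum\<delta>]])
    fix k :: int
    assume "k \<in> {k. k \<noteq> 0}"
    then have "0 \<le> \<omega> k"
      using assms(1) by (simp add: weights_nonneg)
    then show "(\<psi> i - \<psi> (i + k)) * \<omega> k \<le> (\<phi> i - \<phi> (i + k)) * \<omega> k + (\<psi> i - \<phi> i) * \<omega> k"
      using assms(5)[of "i + k"] by (simp add: distrib_right[symmetric] mult_right_mono)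
  qed
  also have "\<dots> = frac_lap \<omega> \<phi> i + (\<psi> i - \<phi> i) * (\<Sum>\<^sub>\<infinity>k\<in>{k. k \<noteq> 0}. \<omega> k)"
    unfolding frac_lap_def
    by (simp add: infsum_add[OF sum[OF assms(3)] sum\<delta>] infsum_cmult_right')
  finally show ?thesis .
qed

text \<open>The crude bound through the oscillation alone. It serves (CFLa), and (CFLb) when
  \<open>h > 1\<close>.\<close>

lemma abs_frac_lap_le:
  assumes "weights \<omega>" "\<omega> summable_on {k. k \<noteq> 0}" "\<phi> \<in> grid_class h N B"
  shows "\<bar>frac_lap \<omega> \<phi> i\<bar> \<le> N * (\<Sum>\<^sub>\<infinity>k\<in>{k. k \<noteq> 0}. \<omega> k)"
proof -
  have "\<bar>frac_lap \<omega> \<phi> i\<bar> \<le> (\<Sum>\<^sub>\<infinity>k\<in>{k. k \<noteq> 0}. N * \<omega> k)"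
    unfolding frac_lap_def real_norm_def[symmetric]
  proof (rule norm_infsum_le)
    show "((\<lambda>k. (\<phi> i - \<phi> (i + k)) * \<omega> k) has_sum
        (\<Sum>\<^sub>\<infinity>k\<in>{k. k \<noteq> 0}. (\<phi> i - \<phi> (i + k)) * \<omega> k)) {k. k \<noteq> 0}"
      by (rule has_sum_infsum[OF frac_lap_summable[OF assms(1,2) grid_class_oscD[OF assms(3)]]])
    show "((\<lambda>k. N * \<omega> k) has_sum (\<Sum>\<^sub>\<infinity>k\<in>{k. k \<noteq> 0}. N * \<omega> k)) {k. k \<noteq> 0}"
      by (rule has_sum_infsum[OF summable_on_cmult_right[OF assms(2)]])
    show "norm ((\<phi> i - \<phi> (i + k)) * \<omega> k) \<le> N * \<omega> k" if "k \<in> {k. k \<noteq> 0}" for k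
      using that assms(1) grid_class_oscD[OF assms(3)]
      by (auto simp: weights_nonneg abs_mult intro!: mult_right_mono)
  qed
  then show ?thesis
    by (simp add: infsum_cmult_right')
qed

text \<open>
  Symmetrising gives second differences $2\phi_i - \phi_{i+k} - \phi_{i-k}$, which for
  nondecreasing $\phi$ are bounded by a single increment, not by the sum of two.
\<close>

lemma abs_frac_lap_le_split:
  assumes "weights \<omega>" "\<omega> summable_on {k. k \<noteq> 0}" "\<phi> \<in> grid_class h N B"
    and "0 < h" "0 \<le> B"
  shows "2 * \<bar>frac_lap \<omega> \<phi> i\<bar> \<le>
    B * (\<Sum>\<^sub>\<infinity>k\<in>{k. 0 < \<bar>of_int k * h\<bar> \<and> \<bar>of_int k * h\<bar> \<le> 1}. \<bar>h * of_int k\<bar> * \<omega> k) +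
    N * (\<Sum>\<^sub>\<infinity>k\<in>{k. \<bar>of_int k * h\<bar> > 1}. \<omega> k)"
proof -
  let ?Z = "{k::int. k \<noteq> 0}"
  let ?S = "{k::int. 0 < \<bar>of_int k * h\<bar> \<and> \<bar>of_int k * h\<bar> \<le> 1}"
  let ?T = "{k::int. \<bar>of_int k * h\<bar> > 1}"
  let ?f = "\<lambda>k. (\<phi> i - \<phi> (i + k)) * \<omega> k"
  let ?f' = "\<lambda>k. (\<phi> i - \<phi> (i - k)) * \<omega> k"
  \<comment> \<open>The majorant of the second differences: slopes control the near interactions
    \<open>?S\<close>, the oscillation controls the far ones \<open>?T\<close>.\<close>
  let ?g = "\<lambda>k. (if k \<in> ?S then \<bar>h * of_int k\<bar> * B else N) * \<omega> k"
  have "0 < \<bar>of_int k * h\<bar> \<longleftrightarrow> k \<noteq> 0" for k :: int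
    using assms(4) by simp
  then have Z: "?Z = ?S \<union> ?T"
    by (intro set_eqI) (unfold mem_Collect_eq Un_iff, smt (verit))
  have disj: "?S \<inter> ?T = {}"
    by (intro equals0I) (unfold mem_Collect_eq Int_iff, linarith)
  have nonneg: "0 \<le> \<omega> k" and sym: "\<omega> (- k) = \<omega> k" if "k \<noteq> 0" for k
    using weights_nonneg[OF assms(1) that] weights_minus[OF assms(1) that] by auto
  have sumf: "?f summable_on ?Z" and sumf': "?f' summable_on ?Z"
    by (rule frac_lap_summable[OF assms(1,2) grid_class_oscD[OF assms(3)]])+
  have sumT: "\<omega> summable_on ?T"
    using assms(2) by (rule summable_on_subset_banach) auto
  have sumS: "(\<lambda>k. \<bar>h * of_int k\<bar> * \<omega> k) summable_on ?S"
  proof (rule summable_on_comparison_test)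
    show "\<omega> summable_on ?S"
      using assms(2) by (rule summable_on_subset_banach) auto
    show "\<bar>h * of_int k\<bar> * \<omega> k \<le> \<omega> k" if "k \<in> ?S" for k
      using that nonneg[of k] by (intro mult_left_le_one_le) (auto simp: mult.commute)
  qed (use nonneg in auto)
  have gS: "?g summable_on ?S" "infsum ?g ?S = B * infsum (\<lambda>k. \<bar>h * of_int k\<bar> * \<omega> k) ?S"
  proof -
    have "?g summable_on ?S \<longleftrightarrow> (\<lambda>k. B * (\<bar>h * of_int k\<bar> * \<omega> k)) summable_on ?S"
      by (rule summable_on_cong) auto
    then show "?g summable_on ?S"
      using summable_on_cmult_right[OF sumS] by simp
    have "infsum ?g ?S = infsum (\<lambda>k. B * (\<bar>h * of_int k\<bar> * \<omega> k)) ?S"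
      by (rule infsum_cong) auto
    then show "infsum ?g ?S = B * infsum (\<lambda>k. \<bar>h * of_int k\<bar> * \<omega> k) ?S"
      by (simp only: infsum_cmult_right')
  qed
  have gT: "?g summable_on ?T" "infsum ?g ?T = N * infsum \<omega> ?T"
  proof -
    have "?g summable_on ?T \<longleftrightarrow> (\<lambda>k. N * \<omega> k) summable_on ?T"
      by (rule summable_on_cong) auto
    then show "?g summable_on ?T"
      using summable_on_cmult_right[OF sumT] by simp
    have "infsum ?g ?T = infsum (\<lambda>k. N * \<omega> k) ?T"
      by (rule infsum_cong) auto
    then show "infsum ?g ?T = N * infsum \<omega> ?T"
      by (simp only: infsum_cmult_right')
  qed
  have incr: "\<bar>2 * \<phi> i - \<phi> (i + k) - \<phi> (i - k)\<bar> \<le> \<bar>h * of_int k\<bar> * B"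
    and osc: "\<bar>2 * \<phi> i - \<phi> (i + k) - \<phi> (i - k)\<bar> \<le> N" for k
  proof -
    \<comment> \<open>The second difference is even in \<open>k\<close>, so \<open>k\<close> may be
      replaced by its absolute value. It is then a backward minus a forward increment; both are
      nonnegative, so its absolute value is at most the larger of the two.\<close>
    define n where "n = nat \<bar>k\<bar>"
    have n: "k = int n \<or> k = - int n" "\<bar>h * of_int k\<bar> = real n * h"
      using assms(4) by (auto simp: n_def abs_mult)
    have eq: "2 * \<phi> i - \<phi> (i + k) - \<phi> (i - k) =
        (\<phi> i - \<phi> (i - int n)) - (\<phi> (i + int n) - \<phi> i)"
      using n(1) by auto
    have "\<phi> (i - int n) \<le> \<phi> i" "\<phi> i \<le> \<phi> (i + int n)"
      using grid_class_monoD[OF assms(3)] by auto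
    moreover have "\<phi> i - \<phi> (i - int n) \<le> real n * h * B" "\<phi> (i + int n) - \<phi> i \<le> real n * h * B"
      using grid_class_slopeD_nat[OF assms(3), of "i - int n" n]
        grid_class_slopeD_nat[OF assms(3), of i n] by (simp_all add: mult.assoc)
    ultimately show "\<bar>2 * \<phi> i - \<phi> (i + k) - \<phi> (i - k)\<bar> \<le> \<bar>h * of_int k\<bar> * B"
      unfolding eq n(2) by linarith
    show "\<bar>2 * \<phi> i - \<phi> (i + k) - \<phi> (i - k)\<bar> \<le> N"
      unfolding eq
      using \<open>\<phi> (i - int n) \<le> \<phi> i\<close> \<open>\<phi> i \<le> \<phi> (i + int n)\<close>
        grid_class_oscD[OF assms(3), of i "i - int n"]
        grid_class_oscD[OF assms(3), of i "i + int n"] by linarith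
  qed
  \<comment> \<open>Reflecting \<open>k\<close> and using the symmetry of the weights writes
    \<open>frac_lap\<close> a second time, with \<open>\<phi> (i - k)\<close>; adding both forms
    produces the second differences.\<close>
  have "bij_betw uminus ?Z ?Z"
    by (rule bij_betwI[where g = uminus]) auto
  then have "infsum ?f ?Z = infsum (\<lambda>k. ?f (- k)) ?Z"
    by (rule infsum_reindex_bij_betw[symmetric])
  also have "\<dots> = infsum ?f' ?Z"
    by (rule infsum_cong) (simp add: sym)
  finally have "2 * frac_lap \<omega> \<phi> i = (\<Sum>\<^sub>\<infinity>k\<in>?Z. ?f k + ?f' k)"
    by (simp add: frac_lap_def infsum_add[OF sumf sumf'])
  moreover have "norm (\<Sum>\<^sub>\<infinity>k\<in>?Z. ?f k + ?f' k) \<le> infsum ?g ?Z"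
  proof (rule norm_infsum_le)
    show "((\<lambda>k. ?f k + ?f' k) has_sum (\<Sum>\<^sub>\<infinity>k\<in>?Z. ?f k + ?f' k)) ?Z"
      by (rule has_sum_infsum[OF summable_on_add[OF sumf sumf']])
    show "(?g has_sum infsum ?g ?Z) ?Z"
      unfolding Z by (rule has_sum_infsum[OF summable_on_Un_disjoint[OF gS(1) gT(1) disj]])
    show "norm (?f k + ?f' k) \<le> ?g k" if "k \<in> ?Z" for k
    proof -
      have "?f k + ?f' k = (2 * \<phi> i - \<phi> (i + k) - \<phi> (i - k)) * \<omega> k"
        by (simp add: algebra_simps)
      then have "norm (?f k + ?f' k) = \<bar>2 * \<phi> i - \<phi> (i + k) - \<phi> (i - k)\<bar> * \<omega> k"
        using nonneg[of k] that by (simp only: real_norm_def abs_mult) simp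
      also have "\<dots> \<le> ?g k"
        using incr[of k] osc[of k] nonneg[of k] that
        by (intro mult_right_mono) (simp only: split: if_split, auto)
      finally show ?thesis .
    qed
  qed
  moreover have "infsum ?g ?Z = infsum ?g ?S + infsum ?g ?T"
    unfolding Z by (rule infsum_Un_disjoint[OF gS(1) gT(1) disj])
  ultimately show ?thesis
    unfolding gS(2) gT(2) real_norm_def by linarith
qed

text \<open>The comparison argument sees the CFL conditions only through \<open>lap_le\<close> and
  \<open>cfl\<close>, so it is carried out once for both. In \<open>cfl\<close> the term with
  \<open>A / h\<close> pays for the change of the slope, the term with the total weight for the
  change of the Laplacian.\<close>

locale cfl_scheme =
  fixes m h \<tau> N B A :: real and \<omega> :: "int \<Rightarrow> real"
  assumes m: "2 \<le> m" and h: "0 < h" and \<tau>: "0 < \<tau>" and N: "0 \<le> N" and B: "0 \<le> B"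
    and weights: "weights \<omega>" and summable: "\<omega> summable_on {k. k \<noteq> 0}"
    and lap_le: "\<phi> \<in> grid_class h N B \<Longrightarrow> \<bar>frac_lap \<omega> \<phi> i\<bar> \<le> A"
    and cfl: "\<tau> * B powr (m - 2) * ((m - 1) * A / h + B * (\<Sum>\<^sub>\<infinity>k\<in>{k. k \<noteq> 0}. \<omega> k)) \<le> 1"
begin

section \<open>The comparison principle and its iteration\<close>

abbreviation "step \<equiv> scheme_step m h \<tau> \<omega>"

abbreviation "K \<equiv> grid_class h N B"

lemma const_in_K: "(\<lambda>_. a) \<in> K"
  using N B h by (intro grid_class_const) auto

text \<open>
  \<open>d, e\<close> are slopes, and \<open>P, Q\<close> are the discrete Laplacians of two grid functions up to sign.
  \<open>Q\<close> may be negative, so that the estimate also covers Laplacians of opposite signs.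
\<close>

lemma flux_diff_le:
  assumes "0 \<le> e" "0 \<le> d" "d \<le> B" "e \<le> B" "d - e \<le> \<delta> / h" "0 \<le> \<delta>"
    and "0 \<le> P" "P \<le> A" "P - Q \<le> \<delta> * (\<Sum>\<^sub>\<infinity>k\<in>{k. k \<noteq> 0}. \<omega> k)"
  shows "\<tau> * (d powr (m - 1) * P - e powr (m - 1) * Q) \<le> \<delta>"
proof -
  let ?\<Omega> = "\<Sum>\<^sub>\<infinity>k\<in>{k. k \<noteq> 0}. \<omega> k"
  have \<Omega>: "0 \<le> ?\<Omega>"
    using weights by (rule infsum_weights_nonneg)
  \<comment> \<open>A one-sided bound on \<open>d - e\<close> suffices: if the slope drops, the left
    side is already nonpositive.\<close>
  have slope: "d powr (m - 1) - e powr (m - 1) \<le> (m - 1) * B powr (m - 2) * (\<delta> / h)"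
  proof (cases "e \<le> d")
    case True
    have "d powr (m - 1) - e powr (m - 1) \<le> (m - 1) * B powr (m - 1 - 1) * (d - e)"
      using m assms True by (intro powr_diff_le) auto
    also have "m - 1 - 1 = m - 2"
      by simp
    also have "(m - 1) * B powr (m - 2) * (d - e) \<le> (m - 1) * B powr (m - 2) * (\<delta> / h)"
      using m assms by (intro mult_left_mono) auto
    finally show ?thesis .
  next
    case False
    then have "d powr (m - 1) \<le> e powr (m - 1)"
      using m assms by (intro powr_mono2) auto
    moreover have "0 \<le> (m - 1) * B powr (m - 2) * (\<delta> / h)"
      using m h assms by simp
    ultimately show ?thesis by linarith
  qed
  note B_powr = powr_minus_two_mult[OF B, of m, symmetric]
  \<comment> \<open>Discrete product rule. The factor of \<open>P - Q\<close> is nonnegative, so an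
    upper bound on \<open>P - Q\<close> is enough.\<close>
  have "d powr (m - 1) * P - e powr (m - 1) * Q =
      (d powr (m - 1) - e powr (m - 1)) * P + e powr (m - 1) * (P - Q)"
    by (simp add: algebra_simps)
  also have "\<dots> \<le> (m - 1) * B powr (m - 2) * (\<delta> / h) * A + B powr (m - 1) * (\<delta> * ?\<Omega>)"
  proof (rule add_mono)
    show "(d powr (m - 1) - e powr (m - 1)) * P \<le> (m - 1) * B powr (m - 2) * (\<delta> / h) * A"
      using slope m h assms by (intro order_trans[OF mult_right_mono mult_left_mono]) auto
    have "e powr (m - 1) * (P - Q) \<le> e powr (m - 1) * (\<delta> * ?\<Omega>)"
      using assms by (intro mult_left_mono) auto
    also have "\<dots> \<le> B powr (m - 1) * (\<delta> * ?\<Omega>)"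
      using assms m \<Omega> by (intro mult_right_mono powr_mono2) auto
    finally show "e powr (m - 1) * (P - Q) \<le> B powr (m - 1) * (\<delta> * ?\<Omega>)" .
  qed
  also have "\<dots> = B powr (m - 2) * ((m - 1) * A / h + B * ?\<Omega>) * \<delta>"
    by (simp add: B_powr algebra_simps diff_divide_distrib)
  finally have "\<tau> * (d powr (m - 1) * P - e powr (m - 1) * Q)
      \<le> \<tau> * (B powr (m - 2) * ((m - 1) * A / h + B * ?\<Omega>) * \<delta>)"
    using \<tau> by (intro mult_left_mono) auto
  also have "\<dots> = \<tau> * B powr (m - 2) * ((m - 1) * A / h + B * ?\<Omega>) * \<delta>"
    by (simp only: mult.assoc)
  also have "\<dots> \<le> \<delta>"
    using cfl assms(6) mult_right_mono by fastforce
  finally show ?thesis .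
qed

text \<open>The signs of the two Laplacians decide which neighbour each upwind slope uses. With
  equal signs both slopes use the same neighbour, whose value is not lower for
  \<open>\<psi>\<close>, so the slope changes in the harmful direction by at most
  \<open>\<delta> / h\<close>.\<close>

lemma step_mono:
  assumes \<phi>: "\<phi> \<in> K" and \<psi>: "\<psi> \<in> K" and le: "\<And>i. \<phi> i \<le> \<psi> i"
  shows "step \<phi> i \<le> step \<psi> i"
proof -
  let ?\<Omega> = "\<Sum>\<^sub>\<infinity>k\<in>{k. k \<noteq> 0}. \<omega> k"
  define \<delta> where "\<delta> = \<psi> i - \<phi> i"
  define a where "a = frac_lap \<omega> \<phi> i"
  define b where "b = frac_lap \<omega> \<psi> i"
  define d where "d = upwind_diff h \<omega> \<phi> i"
  define e where "e = upwind_diff h \<omega> \<psi> i"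
  have \<delta>: "0 \<le> \<delta>"
    using le[of i] by (simp add: \<delta>_def)
  have ab: "b - a \<le> \<delta> * ?\<Omega>"
    using frac_lap_diff_le[OF weights summable \<phi> \<psi> le, of i] by (simp add: a_def b_def \<delta>_def)
  have A: "\<bar>a\<bar> \<le> A" "\<bar>b\<bar> \<le> A"
    using lap_le \<phi> \<psi> by (auto simp: a_def b_def)
  have slope: "0 \<le> upwind_diff h \<omega> \<phi>' i" "upwind_diff h \<omega> \<phi>' i \<le> B" if "\<phi>' \<in> K" for \<phi>'
    using grid_class_monoD[OF that, of i "i + 1"] grid_class_monoD[OF that, of "i - 1" i]
      grid_class_slopeD[OF that, of i] grid_class_slopeD[OF that, of "i - 1"] h
    by (auto simp: upwind_diff_def field_simps)
  note d = slope[OF \<phi>, folded d_def] and e = slope[OF \<psi>, folded e_def]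
  have step_eq: "step \<phi> i = \<phi> i - \<tau> * (d powr (m - 1) * a)"
      "step \<psi> i = \<phi> i + \<delta> - \<tau> * (e powr (m - 1) * b)"
    using d(1) e(1) by (simp_all add: scheme_step_def scheme_op_def a_def b_def d_def e_def \<delta>_def)
  have "\<tau> * (e powr (m - 1) * b - d powr (m - 1) * a) \<le> \<delta>"
  proof (cases "a \<le> 0"; cases "b \<le> 0")
    assume "a \<le> 0" "b \<le> 0"
    then have "d - e = (\<phi> (i + 1) - \<psi> (i + 1) + \<delta>) / h"
      by (simp add: d_def e_def a_def b_def \<delta>_def upwind_diff_def
          diff_divide_distrib add_divide_distrib)
    then have "d - e \<le> \<delta> / h"
      using le[of "i + 1"] h by (simp add: divide_right_mono)
    then have "\<tau> * (d powr (m - 1) * (- a) - e powr (m - 1) * (- b)) \<le> \<delta>"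
      using d e \<delta> A ab \<open>a \<le> 0\<close> by (intro flux_diff_le) auto
    then show ?thesis by simp
  next
    assume "\<not> a \<le> 0" "\<not> b \<le> 0"
    then have "e - d = (\<phi> (i - 1) - \<psi> (i - 1) + \<delta>) / h"
      by (simp add: d_def e_def a_def b_def \<delta>_def upwind_diff_def
          diff_divide_distrib add_divide_distrib)
    then have "e - d \<le> \<delta> / h"
      using le[of "i - 1"] h by (simp add: divide_right_mono)
    then show ?thesis
      using d e \<delta> A ab \<open>\<not> b \<le> 0\<close> by (intro flux_diff_le) auto
  next
    \<comment> \<open>The slopes \<open>d\<close> and \<open>e\<close> now point to different
      neighbours and cannot be compared. Both terms are nonnegative, so both slopes may be raised to
      \<open>?c\<close>; the sum is then an instance of \<open>flux_diff_le\<close> with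
      \<open>P = 0\<close> and negative \<open>Q = a - b\<close>.\<close>
    assume signs: "a \<le> 0" "\<not> b \<le> 0"
    let ?c = "max d e"
    have "e powr (m - 1) * b \<le> ?c powr (m - 1) * b"
      using signs d e m by (intro mult_right_mono powr_mono2) auto
    moreover have "d powr (m - 1) * (- a) \<le> ?c powr (m - 1) * (- a)"
      using signs d e m by (intro mult_right_mono powr_mono2) auto
    ultimately have "e powr (m - 1) * b - d powr (m - 1) * a
        \<le> ?c powr (m - 1) * 0 - ?c powr (m - 1) * (a - b)"
      by (simp add: algebra_simps)
    then have "\<tau> * (e powr (m - 1) * b - d powr (m - 1) * a)
        \<le> \<tau> * (?c powr (m - 1) * 0 - ?c powr (m - 1) * (a - b))"
      using \<tau> by (intro mult_left_mono) auto
    also have "\<dots> \<le> \<delta>"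
      using d e \<delta> h A ab signs by (intro flux_diff_le) auto
    finally show ?thesis .
  next
    \<comment> \<open>The step lowers \<open>\<phi> i\<close> and raises \<open>\<psi> i\<close>, or
      leaves them unchanged, so nothing is lost.\<close>
    assume "\<not> a \<le> 0" "b \<le> 0"
    then have "e powr (m - 1) * b \<le> 0" "0 \<le> d powr (m - 1) * a"
      by (auto intro: mult_nonneg_nonpos)
    then have "\<tau> * (e powr (m - 1) * b - d powr (m - 1) * a) \<le> 0"
      using \<tau> by (intro mult_nonneg_nonpos) auto
    with \<delta> show ?thesis by linarith
  qed
  then show ?thesis
    unfolding step_eq by (simp add: algebra_simps)
qed

text \<open>Adding a constant commutes with the step, so order preservation carries one-sided bounds
  on differences along as well.\<close>

lemma step_le_add_const:
  assumes "\<phi> \<in> K" "\<psi> \<in> K" "\<And>i. \<phi> i \<le> \<psi> i + c"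
  shows "step \<phi> i \<le> step \<psi> i + c"
  using step_mono[OF assms(1) grid_class_add_const[OF assms(2)] assms(3)]
  by (simp add: scheme_step_add_const)

text \<open>Each defining bound is a comparison inside the class: with the shifted function for
  monotonicity and slopes, with a constant for the oscillation.\<close>

lemma step_in_K:
  assumes "\<phi> \<in> K"
  shows "step \<phi> \<in> K"
  unfolding grid_class_def mem_Collect_eq
proof (intro conjI allI)
  note shift = grid_class_shift[OF assms]
  have "step \<phi> i \<le> step \<phi> (i + 1)" for i
    using step_mono[OF assms shift] grid_class_monoD[OF assms] by (simp add: scheme_step_shift)
  then show "mono (step \<phi>)"
    by (intro mono_int_if_le_next)
  show "step \<phi> (i + 1) - step \<phi> i \<le> h * B" for i
    using step_le_add_const[OF shift assms, of "h * B" i] grid_class_slopeD[OF assms]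
    by (simp add: scheme_step_shift algebra_simps)
  show "step \<phi> j - step \<phi> i \<le> N" for i j
  proof -
    have bdd: "bdd_above (range \<phi>)"
      using grid_class_oscD[OF assms, of _ 0]
      by (intro bdd_aboveI[of _ "\<phi> 0 + N"]) (auto simp: abs_le_iff algebra_simps)
    \<comment> \<open>The supremum \<open>b\<close> lies between \<open>\<phi>\<close> and
      \<open>\<phi> + N\<close>. The step fixes the constant \<open>b\<close>, so the same holds
      after the step.\<close>
    define b where "b = (SUP i. \<phi> i)"
    have "\<phi> k \<le> b" for k
      unfolding b_def by (intro cSUP_upper bdd) auto
    then have "step \<phi> j \<le> step (\<lambda>_. b) j"
      by (intro step_mono assms const_in_K)
    moreover have "b \<le> \<phi> k + N" for k
      unfolding b_def using grid_class_oscD[OF assms, of _ k]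
      by (intro cSUP_least) (force simp: abs_le_iff algebra_simps)+
    then have "step (\<lambda>_. b) i \<le> step \<phi> i + N"
      by (intro step_le_add_const assms const_in_K)
    ultimately show ?thesis
      by (simp add: scheme_step_const)
  qed
qed

lemma solution_in_K:
  assumes "scheme_solution m h \<tau> \<omega> V" "V 0 \<in> K"
  shows "V j \<in> K"
  using assms by (induction j) (auto simp: scheme_solution_step intro: step_in_K)

text \<open>The common source of stability, nonnegativity, comparison, contraction and the Lipschitz
  bound: constants and shifts of solutions are solutions too, and \<open>c\<close> is free.\<close>

lemma solution_le_add_const:
  assumes "scheme_solution m h \<tau> \<omega> V" "scheme_solution m h \<tau> \<omega> W" "V 0 \<in> K" "W 0 \<in> K"
    and "\<And>i. V 0 i \<le> W 0 i + c"
  shows "V j i \<le> W j i + c"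
proof (induction j arbitrary: i)
  case (Suc j)
  then show ?case
    using assms by (auto simp: scheme_solution_step intro!: step_le_add_const solution_in_K)
qed (use assms in simp)

end

text \<open>Reduces a bound by a supremum to real upper bounds. If \<open>f\<close> is unbounded
  above, the supremum is infinite and the claim trivial; it is never minus infinity, since the index
  type is inhabited.\<close>

lemma ereal_le_SUP_if_all_bounds:
  fixes f :: "'a \<Rightarrow> real"
  assumes "\<And>c. (\<And>i. f i \<le> c) \<Longrightarrow> x \<le> c"
  shows "ereal x \<le> (SUP i. ereal (f i))"
proof (cases "SUP i. ereal (f i)")
  case (real c)
  have "ereal (f i) \<le> ereal c" for i
    unfolding real[symmetric] by (rule SUP_upper) simp
  then show ?thesis
    using assms real by simp
next
  case MInf
  moreover have "ereal (f undefined) \<le> (SUP i. ereal (f i))"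
    by (rule SUP_upper) simp
  ultimately show ?thesis by simp
qed simp

section \<open>From the CFL conditions to the comparison principle\<close>

lemma cfl_scheme_of_osc_bound:
  assumes "2 \<le> m" "0 < h" "0 < \<tau>" "0 \<le> B" "B \<le> N / h"
    and weights: "weights \<omega>" and summable: "\<omega> summable_on {k. k \<noteq> 0}"
    and cfl: "\<tau> * m * B powr (m - 2) * (N / h) * (\<Sum>\<^sub>\<infinity>k\<in>{k. k \<noteq> 0}. \<omega> k) \<le> 1"
  shows "cfl_scheme m h \<tau> N B (N * (\<Sum>\<^sub>\<infinity>k\<in>{k. k \<noteq> 0}. \<omega> k)) \<omega>"
proof
  let ?\<Omega> = "\<Sum>\<^sub>\<infinity>k\<in>{k. k \<noteq> 0}. \<omega> k"
  have "0 \<le> ?\<Omega>"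
    using weights by (rule infsum_weights_nonneg)
  \<comment> \<open>Since \<open>B \<le> N / h\<close>, the second term is at most one more copy of
    \<open>N * ?\<Omega> / h\<close>; together with the \<open>m - 1\<close> copies this gives the
    factor \<open>m\<close>.\<close>
  then have "\<tau> * B powr (m - 2) * ((m - 1) * (N * ?\<Omega>) / h + B * ?\<Omega>)
      \<le> \<tau> * B powr (m - 2) * ((m - 1) * (N * ?\<Omega>) / h + N / h * ?\<Omega>)"
    using assms by (intro mult_left_mono add_left_mono mult_right_mono) auto
  also have "\<dots> = \<tau> * m * B powr (m - 2) * (N / h) * ?\<Omega>"
    using assms(2) by (simp add: field_simps)
  finally show "\<tau> * B powr (m - 2) * ((m - 1) * (N * ?\<Omega>) / h + B * ?\<Omega>) \<le> 1"
    using cfl by linarith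
  have "0 \<le> N / h"
    using assms(4,5) by linarith
  then show "0 \<le> N"
    using assms(2) by (simp add: zero_le_divide_iff)
qed (use assms abs_frac_lap_le in auto)

text \<open>The oscillation alone bounds the slopes by \<open>2 * M / h\<close>. In the exponent of
  \<open>h\<close>, the slopes account for \<open>m - 1\<close> and the total weight for
  \<open>2 * s\<close>.\<close>

lemma CFLa_cfl_scheme:
  assumes "2 \<le> m" "0 < h" "0 < \<tau>" "weights \<omega>" "A_m s h C \<omega>" "CFLa s m h \<tau> C M V0 W0"
  shows "\<exists>A. cfl_scheme m h \<tau> (2 * M) (2 * M / h) A \<omega>"
proof (rule exI, rule cfl_scheme_of_osc_bound)
  let ?\<Omega> = "\<Sum>\<^sub>\<infinity>k\<in>{k. k \<noteq> 0}. \<omega> k"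
  let ?B = "2 * M / h"
  have "\<bar>V0 0\<bar> \<le> M"
    using assms(6) by (auto simp: CFLa_def)
  then have M: "0 \<le> M" by linarith
  then show B: "0 \<le> ?B"
    using assms(2) by auto
  have \<Omega>: "?\<Omega> \<le> C * h powr (- 2 * s)"
    using assms(5) by (simp add: A_m_def)
  have "\<tau> * m * ?B powr (m - 2) * ?B * ?\<Omega> = \<tau> * m * ?B powr (m - 1) * ?\<Omega>"
    by (simp only: mult.assoc powr_minus_two_mult[OF B, symmetric])
  also have "\<dots> \<le> \<tau> * m * ?B powr (m - 1) * (C * h powr (- 2 * s))"
    using assms(1,3) \<Omega> by (intro mult_left_mono) auto
  also have "\<dots> = \<tau> * C1_inv m C M * (h powr (- (m - 1)) * h powr (- 2 * s))"
    using M assms(2) unfolding powr_minus[of h "m - 1"]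
    by (simp add: C1_inv_def powr_divide field_simps)
  also have "h powr (- (m - 1)) * h powr (- 2 * s) = h powr - (2 * s + m - 1)"
    by (simp add: algebra_simps flip: powr_add)
  also have "\<tau> * C1_inv m C M * h powr - (2 * s + m - 1) \<le> 1"
    using assms(2,6) unfolding powr_minus by (simp add: CFLa_def field_simps)
  finally show "\<tau> * m * ?B powr (m - 2) * ?B * ?\<Omega> \<le> 1" .
qed (use assms in \<open>auto simp: A_m_def\<close>)

text \<open>For \<open>h > 1\<close> the cap \<open>2 * M / h\<close> on the slopes makes the crude
  oscillation bound applicable; for \<open>h \<le> 1\<close> the Laplacian is split into near and
  far interactions.\<close>

lemma CFLb_cfl_scheme:
  assumes "2 \<le> m" "0 < h" "0 < \<tau>" "0 < C" "weights \<omega>" "A_m s h C \<omega>"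
    and CFLb: "CFLb s m h \<tau> C M L V0 W0" and guard: "log_guard s m h \<tau> C M L"
    and "0 < s"
  shows "\<exists>A. cfl_scheme m h \<tau> (2 * M) (min L (2 * M / h)) A \<omega>"
proof -
  let ?\<Omega> = "\<Sum>\<^sub>\<infinity>k\<in>{k. k \<noteq> 0}. \<omega> k"
  let ?B = "min L (2 * M / h)"
  let ?N = "max L (2 * M)"
  have "\<bar>V0 0\<bar> \<le> M"
    using CFLb by (auto simp: CFLb_def)
  then have M: "0 \<le> M" by linarith
  have "\<bar>V0 (0 + 1) - V0 0\<bar> / h \<le> L"
    using CFLb unfolding CFLb_def by blast
  then have L: "0 \<le> L"
    using assms(2) by (meson abs_ge_zero divide_nonneg_pos order_trans)
  have B: "0 \<le> ?B"
    using M L assms(2) by auto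
  have B_powr: "?B powr (m - 2) \<le> L powr (m - 2)"
    using B assms(1) by (intro powr_mono2) auto
  have \<Omega>_nonneg: "0 \<le> ?\<Omega>"
    using assms(5) by (rule infsum_weights_nonneg)
  have summable: "\<omega> summable_on {k. k \<noteq> 0}" and \<Omega>: "?\<Omega> \<le> C * h powr (- 2 * s)"
    using assms(6) by (simp_all add: A_m_def)
  \<comment> \<open>For \<open>s = 1/2\<close> this is the guard; otherwise
    \<open>f_inv s h = 1\<close> and it is (CFLb) itself.\<close>
  have cfl: "\<tau> * C2_inv m C M L \<le> h powr max (2 * s) 1"
  proof (cases "s = 1/2")
    case True
    with guard show ?thesis
      unfolding log_guard_def by blast
  next
    case False
    with CFLb show ?thesis
      by (simp add: CFLb_def f_inv_def)
  qed
  have C2: "\<tau> * C2_inv m C M L = \<tau> * m * L powr (m - 2) * (?N * C)"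
    by (simp add: C2_inv_def)
  show ?thesis
  proof (cases "1 < h")
    case True
    have "\<tau> * m * ?B powr (m - 2) * (2 * M / h) * ?\<Omega>
        \<le> \<tau> * m * L powr (m - 2) * (?N / h) * (C * h powr (- 2 * s))"
      using assms M L B_powr \<Omega> \<Omega>_nonneg
      by (intro mult_mono mult_nonneg_nonneg divide_right_mono) auto
    also have "\<dots> = \<tau> * C2_inv m C M L * (h powr - 1 * h powr (- 2 * s))"
      using assms(2) unfolding C2 by (simp add: powr_minus_divide[of h 1])
    also have "\<dots> \<le> h powr max (2 * s) 1 * (h powr - 1 * h powr (- 2 * s))"
      using cfl by (intro mult_right_mono) auto
    also have "\<dots> = h powr (max (2 * s) 1 + (- 1 + - 2 * s))"
      by (simp only: powr_add)
    \<comment> \<open>The exponent is nonpositive, since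
      \<open>max (2 * s) 1 \<le> 1 + 2 * s\<close>.\<close>
    also have "\<dots> \<le> h powr 0"
      using True assms(9) by (intro powr_mono) auto
    finally have coarse: "\<tau> * m * ?B powr (m - 2) * (2 * M / h) * ?\<Omega> \<le> 1"
      using assms(2) by simp
    show ?thesis
      by (intro exI, rule cfl_scheme_of_osc_bound[OF assms(1-3) B _ assms(5) summable coarse]) simp
  next
    case False
    \<comment> \<open>Far interactions contribute \<open>C\<close> without the factor
      \<open>rho s h\<close>, which for \<open>s = 1/2\<close> drops below \<open>1\<close> as
      \<open>h\<close> approaches \<open>1\<close>.\<close>
    let ?R = "max (rho s h) 1"
    have "cfl_scheme m h \<tau> (2 * M) ?B (?N * C * ?R) \<omega>"
    proof
      show "\<bar>frac_lap \<omega> \<phi> i\<bar> \<le> ?N * C * ?R" if "\<phi> \<in> grid_class h (2 * M) ?B" for \<phi> i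
      proof -
        have "2 * \<bar>frac_lap \<omega> \<phi> i\<bar> \<le>
          ?B * (\<Sum>\<^sub>\<infinity>k\<in>{k. 0 < \<bar>of_int k * h\<bar> \<and> \<bar>of_int k * h\<bar> \<le> 1}. \<bar>h * of_int k\<bar> * \<omega> k) +
          2 * M * (\<Sum>\<^sub>\<infinity>k\<in>{k. \<bar>of_int k * h\<bar> > 1}. \<omega> k)"
          by (rule abs_frac_lap_le_split[OF assms(5) summable that assms(2) B])
        also have "\<dots> \<le> ?B * (C * rho s h) + 2 * M * C"
          using assms(6) B M by (intro add_mono mult_left_mono) (auto simp: A_m_def)
        \<comment> \<open>Each part is at most \<open>?N * C * ?R\<close>, and the \<open>2\<close>
          gained by symmetrising absorbs their sum.\<close>
        also have "\<dots> \<le> ?N * C * ?R + ?N * C * ?R"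
        proof (rule add_mono)
          have "?B * (C * rho s h) \<le> ?B * (C * ?R)"
            using assms(4) B by (intro mult_left_mono) auto
          also have "\<dots> \<le> ?N * (C * ?R)"
            using assms(4) by (intro mult_right_mono) auto
          also have "\<dots> = ?N * C * ?R"
            by (simp only: mult.assoc)
          finally show "?B * (C * rho s h) \<le> ?N * C * ?R" .
          have "2 * M * C * 1 \<le> ?N * C * ?R"
            using assms(4) M by (intro mult_mono) auto
          then show "2 * M * C \<le> ?N * C * ?R"
            by simp
        qed
        finally show ?thesis by linarith
      qed
      \<comment> \<open>Through this bound \<open>h\<close> times the total weight is at most
        \<open>C * ?R\<close>, so the second term of \<open>cfl\<close> completes
        \<open>m - 1\<close> to \<open>m\<close>.\<close>
      have h_le: "h powr (1 - 2 * s) \<le> ?R"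
      proof (cases "s \<le> 1/2")
        case True
        then have "h powr (1 - 2 * s) \<le> 1 powr (1 - 2 * s)"
          using False assms(2) by (intro powr_mono2) auto
        then show ?thesis by simp
      qed (simp add: rho_def)
      \<comment> \<open>At \<open>s = 1/2\<close> both inequalities enter: (CFLb) when
        \<open>?R\<close> is the logarithm, the guard when it is \<open>1\<close>.\<close>
      have R_cfl: "\<tau> * C2_inv m C M L * ?R \<le> h"
      proof (cases s "1/2 :: real" rule: linorder_cases)
        case less
        then show ?thesis
          using cfl assms(2) by (simp add: rho_def max_def)
      next
        case equal
        have "\<tau> * C2_inv m C M L * \<bar>ln h\<bar> \<le> h"
          using CFLb assms(2) equal by (simp add: CFLb_def f_inv_def)
        then show ?thesis
          using cfl assms(2) equal by (simp add: rho_def max_def)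
      next
        case greater
        have "h powr 0 \<le> h powr (1 - 2 * s)"
          using greater False assms(2) by (intro powr_mono') auto
        then have R: "?R = h powr (1 - 2 * s)"
          using greater assms(2) by (simp add: rho_def)
        have "\<tau> * C2_inv m C M L * h powr (1 - 2 * s) \<le> h powr (2 * s) * h powr (1 - 2 * s)"
          using cfl greater by (intro mult_right_mono) (auto simp: max_def)
        also have "\<dots> = h"
          using assms(2) by (simp flip: powr_add)
        finally show ?thesis unfolding R .
      qed
      have "?B * ?\<Omega> \<le> ?N * (C * h powr (- 2 * s))"
        using B \<Omega> \<Omega>_nonneg L by (intro mult_mono) auto
      also have "\<dots> = ?N * C * h powr (1 - 2 * s) / h"
        using assms(2) by (simp add: powr_diff powr_minus field_simps)
      also have "\<dots> \<le> ?N * C * ?R / h"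
        using h_le assms(2,4) L by (intro divide_right_mono mult_left_mono) (auto simp: le_max_iff_disj)
      finally have "(m - 1) * (?N * C * ?R) / h + ?B * ?\<Omega> \<le> m * (?N * C * ?R) / h"
        by (simp add: left_diff_distrib diff_divide_distrib)
      moreover have "0 \<le> m * (?N * C * ?R) / h"
        using assms(1,2,4) L by (auto intro!: divide_nonneg_pos mult_nonneg_nonneg simp: le_max_iff_disj)
      ultimately have "\<tau> * ?B powr (m - 2) * ((m - 1) * (?N * C * ?R) / h + ?B * ?\<Omega>)
          \<le> \<tau> * L powr (m - 2) * (m * (?N * C * ?R) / h)"
        using assms(3) B_powr
        by (intro order_trans[OF mult_left_mono mult_right_mono] mult_left_mono) auto
      also have "\<dots> = \<tau> * C2_inv m C M L * ?R / h"
        unfolding C2 by simp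
      also have "\<dots> \<le> 1"
        using R_cfl assms(2) by simp
      finally show "\<tau> * ?B powr (m - 2) * ((m - 1) * (?N * C * ?R) / h + ?B * ?\<Omega>) \<le> 1" .
    qed (use assms B M summable in auto)
    then show ?thesis ..
  qed
qed

lemma grid_class_of_bounds:
  assumes "0 < h" "mono \<phi>" "\<And>i. \<bar>\<phi> i\<bar> \<le> M" "\<And>i. \<phi> (i + 1) - \<phi> i \<le> h * B"
  shows "\<phi> \<in> grid_class h (2 * M) B"
proof -
  have "\<phi> j - \<phi> i \<le> 2 * M" for i j
    using assms(3)[of i] assms(3)[of j] by linarith
  with assms show ?thesis
    by (auto simp: grid_class_def)
qed

text \<open>Both initial data are placed in one class, so that they can be compared with each
  other.\<close>

lemma CFL_cfl_scheme:
  assumes "0 < s" "2 \<le> m" "0 < h" "0 < \<tau>" "0 < C" "weights \<omega>" "A_m s h C \<omega>" "mono V0" "mono W0"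
    and "CFLa s m h \<tau> C M V0 W0 \<or> (CFLb s m h \<tau> C M L V0 W0 \<and> log_guard s m h \<tau> C M L)"
  obtains B A where "cfl_scheme m h \<tau> (2 * M) B A \<omega>"
    "V0 \<in> grid_class h (2 * M) B" "W0 \<in> grid_class h (2 * M) B"
proof -
  have bound: "\<bar>V0 i\<bar> \<le> M" "\<bar>W0 i\<bar> \<le> M" for i
    using assms(10) by (auto simp: CFLa_def CFLb_def)
  have osc: "V0 (i + 1) - V0 i \<le> 2 * M" "W0 (i + 1) - W0 i \<le> 2 * M" for i
    using bound[of i] bound[of "i + 1"] by linarith+
  from assms(10) show thesis
  proof
    assume CFLa: "CFLa s m h \<tau> C M V0 W0"
    obtain A where "cfl_scheme m h \<tau> (2 * M) (2 * M / h) A \<omega>"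
      using CFLa_cfl_scheme[OF assms(2-4,6,7) CFLa] by blast
    then show thesis
      using assms(3,8,9) bound osc by (intro that grid_class_of_bounds) auto
  next
    assume CFLb: "CFLb s m h \<tau> C M L V0 W0 \<and> log_guard s m h \<tau> C M L"
    then have lip: "\<bar>V0 (i + 1) - V0 i\<bar> \<le> h * L" "\<bar>W0 (i + 1) - W0 i\<bar> \<le> h * L" for i
      using assms(3) by (auto simp: CFLb_def field_simps)
    have slope: "V0 (i + 1) - V0 i \<le> h * min L (2 * M / h)"
        "W0 (i + 1) - W0 i \<le> h * min L (2 * M / h)" for i
      using osc[of i] lip[of i] assms(3) by (auto simp: min_def)
    obtain A where "cfl_scheme m h \<tau> (2 * M) (min L (2 * M / h)) A \<omega>"
      using CFLb_cfl_scheme[OF assms(2-7) _ _ assms(1)] CFLb by blast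
    then show thesis
      using assms(3,8,9) bound slope by (intro that grid_class_of_bounds) auto
  qed
qed

section \<open>Properties of solutions under either CFL condition\<close>

theorem corollary5p3:
  fixes s m h \<tau> C\<^sub>s M L :: real
    and \<omega> :: "int \<Rightarrow> real"
    and V W :: "nat \<Rightarrow> int \<Rightarrow> real"
  assumes "0 < s" and "s < 1" and "2 \<le> m" and "0 < h" and "0 < \<tau>" and "0 < C\<^sub>s"
    and "weights \<omega>" and "A_m s h C\<^sub>s \<omega>"
    and "mono (V 0)" and "mono (W 0)"
    and "scheme_solution m h \<tau> \<omega> V" and "scheme_solution m h \<tau> \<omega> W"
    and "CFLa s m h \<tau> C\<^sub>s M (V 0) (W 0) \<or>
         (CFLb s m h \<tau> C\<^sub>s M L (V 0) (W 0) \<and> log_guard s m h \<tau> C\<^sub>s M L)"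
  shows "(\<forall>i j. V j i \<le> V j (i + 1)) \<and>
    ((SUP (i, j). ereal \<bar>V j i\<bar>) \<le> (SUP i. ereal \<bar>V 0 i\<bar>) \<and>
       (SUP i. ereal \<bar>V 0 i\<bar>) \<le> ereal M) \<and>
    ((\<forall>i. 0 \<le> V 0 i) \<longrightarrow> (\<forall>i j. 0 \<le> V j i)) \<and>
    ((\<forall>i. V 0 i \<le> W 0 i) \<longrightarrow> (\<forall>i j. V j i \<le> W j i)) \<and>
    (SUP (i, j). ereal \<bar>W j i - V j i\<bar>) \<le> (SUP i. ereal \<bar>W 0 i - V 0 i\<bar>) \<and>
    (SUP (i, j). ereal (\<bar>V j (i + 1) - V j i\<bar> / h))
       \<le> (SUP i. ereal (\<bar>V 0 (i + 1) - V 0 i\<bar> / h))"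
proof -
  obtain B A where cfl: "cfl_scheme m h \<tau> (2 * M) B A \<omega>"
    and V0: "V 0 \<in> grid_class h (2 * M) B" and W0: "W 0 \<in> grid_class h (2 * M) B"
    using CFL_cfl_scheme[OF assms(1,3-10,13)] .
  interpret cfl_scheme m h \<tau> "2 * M" B A \<omega>
    by (fact cfl)
  note V = assms(11) and W = assms(12)
  have const: "scheme_solution m h \<tau> \<omega> (\<lambda>_ _. a)" for a
    by (simp add: scheme_solution_def scheme_op_def frac_lap_def)
  have shift: "scheme_solution m h \<tau> \<omega> (\<lambda>j i. V j (i + 1))"
    using V by (simp add: scheme_solution_def scheme_op_def frac_lap_def upwind_diff_def ac_simps)
  have V_mono: "V j i \<le> V j (i + 1)" for i j
    using grid_class_monoD[OF solution_in_K[OF V V0]] by simp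
  have stable: "ereal \<bar>V j i\<bar> \<le> (SUP i. ereal \<bar>V 0 i\<bar>)" for i j
  proof (rule ereal_le_SUP_if_all_bounds)
    fix c
    assume le: "\<bar>V 0 i\<bar> \<le> c" for i
    \<comment> \<open>Comparison with the zero solution from both sides.\<close>
    have "V 0 i \<le> 0 + c" "0 \<le> V 0 i + c" for i
      using le[of i] by linarith+
    then show "\<bar>V j i\<bar> \<le> c"
      using solution_le_add_const[OF V const V0 const_in_K, of 0 c j i]
        solution_le_add_const[OF const V const_in_K V0, of 0 c j i] by (simp add: abs_le_iff)
  qed
  have bound: "ereal \<bar>V 0 i\<bar> \<le> ereal M" for i
    using assms(13) by (auto simp: CFLa_def CFLb_def)
  have nonneg: "0 \<le> V j i" if "\<forall>i. 0 \<le> V 0 i" for i j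
    using solution_le_add_const[OF const V const_in_K V0, of 0 0 j i] that by simp
  have comparison: "V j i \<le> W j i" if "\<forall>i. V 0 i \<le> W 0 i" for i j
    using solution_le_add_const[OF V W V0 W0, of 0 j i] that by simp
  have contraction: "ereal \<bar>W j i - V j i\<bar> \<le> (SUP i. ereal \<bar>W 0 i - V 0 i\<bar>)" for i j
  proof (rule ereal_le_SUP_if_all_bounds)
    fix c
    assume le: "\<bar>W 0 i - V 0 i\<bar> \<le> c" for i
    have "V 0 i \<le> W 0 i + c" "W 0 i \<le> V 0 i + c" for i
      using le[of i] by linarith+
    then show "\<bar>W j i - V j i\<bar> \<le> c"
      using solution_le_add_const[OF V W V0 W0, of c j i]
        solution_le_add_const[OF W V W0 V0, of c j i] by (simp add: abs_le_iff)
  qed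
  have lipschitz: "ereal (\<bar>V j (i + 1) - V j i\<bar> / h)
      \<le> (SUP i. ereal (\<bar>V 0 (i + 1) - V 0 i\<bar> / h))" for i j
  proof (rule ereal_le_SUP_if_all_bounds)
    fix c
    assume le: "\<bar>V 0 (i + 1) - V 0 i\<bar> / h \<le> c" for i
    have "\<bar>V 0 (i + 1) - V 0 i\<bar> \<le> h * c" for i
      using le[of i] assms(4) by (simp add: field_simps)
    then have "V 0 (i + 1) \<le> V 0 i + h * c" for i
      by (smt (verit))
    \<comment> \<open>The shifted solution stays below \<open>V\<close> plus \<open>h * c\<close>;
      monotonicity turns this one-sided bound into one on the absolute value.\<close>
    then show "\<bar>V j (i + 1) - V j i\<bar> / h \<le> c"
      using solution_le_add_const[OF shift V grid_class_shift[OF V0] V0, of "h * c" j i]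
        V_mono[of j i] assms(4) by (simp add: field_simps)
  qed
  have "(SUP (i, j). ereal \<bar>V j i\<bar>) \<le> (SUP i. ereal \<bar>V 0 i\<bar>)"
    by (rule SUP_least) (simp add: case_prod_beta stable)
  moreover have "(SUP i. ereal \<bar>V 0 i\<bar>) \<le> ereal M"
    by (rule SUP_least) (rule bound)
  moreover have "(SUP (i, j). ereal \<bar>W j i - V j i\<bar>) \<le> (SUP i. ereal \<bar>W 0 i - V 0 i\<bar>)"
    by (rule SUP_least) (simp add: case_prod_beta contraction del: ereal_minus)
  moreover have "(SUP (i, j). ereal (\<bar>V j (i + 1) - V j i\<bar> / h))
      \<le> (SUP i. ereal (\<bar>V 0 (i + 1) - V 0 i\<bar> / h))"
    by (rule SUP_least) (simp only: case_prod_beta lipschitz)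
  ultimately show ?thesis
    using V_mono nonneg comparison by blast
qed

end
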